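(* Let $A, B \subset \mathbb{R}^n$ be non-empty compact sets and let a uniform grid with spacing $h>0$ be given which covers $A \cup B$. Then the approximation error $\delta = d_H(A,B) - \tilde{d}(A,B)$ satisfies $$\delta \le \sqrt{n} \cdot h.$$
   Context: $|\cdot|$ is the Euclidean norm on $\mathbb{R}^n$. For a set $\Omega \subset \mathbb{R}^n$, $d_\Omega(x) = \inf_{y \in \Omega} |x-y|$. The Hausdorff distance is $d_H(A,B) = \max(d(A \to B), d(B \to A))$ with $d(A \to B) = \sup_{x \in A} \inf_{y \in B} |x-y|$. Grid: a bounded rectangular grid in $\mathbb{R}^n$ with uniform spacing $h>0$ in each dimension, i.e. $N = \{p + h j : j \in \mathbb{Z}^n,\ 0 \le j_i \le K_i \text{ for } i=1,\dots,n\}$ for some $p \in \mathbb{R}^n$ and integers $K_i \ge 1$, is the finite set of grid points. $C$ is the finite set of grid cells; for $c \in C$, $N(c) \subset N$ is the set of the $2^n$ corners of $c$ (a cube of side length $h$), and $\mathrm{co}(N(c))$ is their convex hull. The grid covers $A\cup B$ if for each $y \in A \cup B$ there is $c \in C$ with $y \in \mathrm{co}(N(c))$. The grid approximation of the Hausdorff distance is $\tilde{d}(A,B) = \max_{x \in N} |d_A(x) - d_B(x)|$. *)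

theory Defs
  imports "HOL-Analysis.Analysis"
begin

text \<open>The distance function of a set is \<^const>\<open>infdist\<close>. On \<^typ>\<open>real ^ 'n\<close>, \<^const>\<open>dist\<close> is the
  Euclidean distance. The real-valued suprema below are the mathematical ones for non-empty
  bounded sets, which covers the non-empty compact case.\<close>

definition hausdorff_excess :: "'a::metric_space set \<Rightarrow> 'a set \<Rightarrow> real" where
  "hausdorff_excess A B = (SUP x\<in>A. infdist x B)"

definition hausdorff_dist :: "'a::metric_space set \<Rightarrow> 'a set \<Rightarrow> real" where
  "hausdorff_dist A B = max (hausdorff_excess A B) (hausdorff_excess B A)"

definition grid_point :: "real ^ 'n \<Rightarrow> real \<Rightarrow> int ^ 'n \<Rightarrow> real ^ 'n" where
  "grid_point p h j = p + h *\<^sub>R (\<chi> i. real_of_int (j $ i))"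

definition grid_points :: "real ^ 'n \<Rightarrow> real \<Rightarrow> int ^ 'n \<Rightarrow> (real ^ 'n) set" where
  "grid_points p h K = {grid_point p h j | j. \<forall>i. 0 \<le> j $ i \<and> j $ i \<le> K $ i}"

text \<open>A cell is represented by the index of its lowest corner, so that the index is strictly
  below \<open>K\<close> in each coordinate.\<close>

definition grid_cells :: "int ^ 'n \<Rightarrow> (int ^ 'n) set" where
  "grid_cells K = {c. \<forall>i. 0 \<le> c $ i \<and> c $ i < K $ i}"

definition cell_corners :: "real ^ 'n \<Rightarrow> real \<Rightarrow> int ^ 'n \<Rightarrow> (real ^ 'n) set" where
  "cell_corners p h c = {grid_point p h (c + e) | e. \<forall>i. e $ i \<in> {0, 1}}"

definition grid_covers :: "real ^ 'n \<Rightarrow> real \<Rightarrow> int ^ 'n \<Rightarrow> (real ^ 'n) set \<Rightarrow> bool" where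
  "grid_covers p h K S \<longleftrightarrow> (\<forall>y\<in>S. \<exists>c\<in>grid_cells K. y \<in> convex hull (cell_corners p h c))"

definition grid_hausdorff_dist ::
  "real ^ 'n \<Rightarrow> real \<Rightarrow> int ^ 'n \<Rightarrow> (real ^ 'n) set \<Rightarrow> (real ^ 'n) set \<Rightarrow> real" where
  "grid_hausdorff_dist p h K A B = Max ((\<lambda>x. \<bar>infdist x A - infdist x B\<bar>) ` grid_points p h K)"

lemma finite_grid_points: "finite (grid_points p h K)"
proof -
  let ?F = "PiE UNIV (\<lambda>i. {0..K $ i})"
  have "grid_points p h K \<subseteq> (\<lambda>f. grid_point p h (vec_lambda f)) ` ?F"
  proof
    fix x assume "x \<in> grid_points p h K"
    then obtain j where j: "x = grid_point p h j" "\<forall>i. 0 \<le> j $ i \<and> j $ i \<le> K $ i"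
      unfolding grid_points_def by blast
    then have "vec_nth j \<in> ?F" by auto
    moreover have "x = grid_point p h (vec_lambda (vec_nth j))" using j by simp
    ultimately show "x \<in> (\<lambda>f. grid_point p h (vec_lambda f)) ` ?F" by blast
  qed
  moreover have "finite ?F" by (intro finite_PiE) auto
  ultimately show ?thesis by (meson finite_imageI finite_subset)
qed

lemma grid_points_nonempty:
  assumes "\<forall>i. 1 \<le> K $ i"
  shows "grid_points p h K \<noteq> {}"
proof -
  have "0 \<le> K $ i" for i
    using assms[rule_format, of i] by linarith
  then have "grid_point p h 0 \<in> grid_points p h K"
    unfolding grid_points_def by (auto intro!: exI[of _ 0])
  then show ?thesis by blast
qed

lemma cell_corners_subset_grid_points:
  assumes "c \<in> grid_cells K"
  shows "cell_corners p h c \<subseteq> grid_points p h K"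
proof
  fix x assume "x \<in> cell_corners p h c"
  then obtain e where e: "x = grid_point p h (c + e)" "\<forall>i. e $ i \<in> {0, 1}"
    unfolding cell_corners_def by blast
  have "0 \<le> (c + e) $ i \<and> (c + e) $ i \<le> K $ i" for i
  proof -
    have "e $ i = 0 \<or> e $ i = 1" "0 \<le> c $ i" "c $ i < K $ i"
      using e assms unfolding grid_cells_def by auto
    then show ?thesis by auto
  qed
  then show "x \<in> grid_points p h K"
    using e unfolding grid_points_def by blast
qed

end

theory Submission
  imports Defs
begin

text \<open>Distance functions are 1-Lipschitz. If \<open>y \<in> A\<close> lies in a cell, rounding each coordinate
  gives a corner \<open>x\<close> with \<open>|x - y| \<le> \<surd>n h / 2\<close>; passing from \<open>y\<close> to \<open>x\<close> changes
  \<open>d\<^sub>A\<close> and \<open>d\<^sub>B\<close> by at most this much each, so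
  \<open>d\<^sub>B y = d\<^sub>B y - d\<^sub>A y \<le> d\<^sub>B x - d\<^sub>A x + \<surd>n h\<close>.\<close>

text \<open>Boxes are convex, so only the corners have to be checked. The inclusion turns membership
  in the hull into coordinatewise bounds, which rounding requires.\<close>

lemma convex_hull_cell_corners_subset:
  fixes p :: "real ^ 'n"
  assumes "0 \<le> h"
  shows "convex hull (cell_corners p h c) \<subseteq> cbox (grid_point p h c) (grid_point p h (c + 1))"
proof (rule hull_minimal)
  show "cell_corners p h c \<subseteq> cbox (grid_point p h c) (grid_point p h (c + 1))"
  proof
    fix x assume "x \<in> cell_corners p h c"
    then obtain e where e: "x = grid_point p h (c + e)" "\<And>i. e $ i = 0 \<or> e $ i = 1"
      unfolding cell_corners_def by auto
    have "h * real_of_int (c $ i) \<le> h * real_of_int (c $ i + e $ i)"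
      and "h * real_of_int (c $ i + e $ i) \<le> h * real_of_int (c $ i + 1)" for i
      using e(2)[of i] assms by (auto intro!: mult_left_mono)
    then show "x \<in> cbox (grid_point p h c) (grid_point p h (c + 1))"
      by (auto simp: e(1) mem_box_cart grid_point_def)
  qed
qed (rule convex_box)

lemma exists_cell_corner_near:
  fixes p y :: "real ^ 'n"
  assumes "0 \<le> h" and "y \<in> convex hull (cell_corners p h c)"
  shows "\<exists>x\<in>cell_corners p h c. dist x y \<le> sqrt (real CARD('n)) * h / 2"
proof -
  \<comment> \<open>In each coordinate \<open>e\<close> selects the nearer of the two faces of the
    cell, with ties going to the lower one.\<close>
  define e :: "int ^ 'n" where
    "e = (\<chi> i. if y $ i \<le> p $ i + h * real_of_int (c $ i) + h / 2 then 0 else 1)"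
  define x where "x = grid_point p h (c + e)"
  have "x \<in> cell_corners p h c"
    unfolding x_def cell_corners_def by (auto intro!: exI[of _ e] simp: e_def split: if_splits)
  moreover have "y \<in> cbox (grid_point p h c) (grid_point p h (c + 1))"
    using convex_hull_cell_corners_subset assms by blast
  \<comment> \<open>The comparison vector has all entries h/2, hence norm
    \<open>sqrt (real CARD('n)) * h / 2\<close>.\<close>
  then have "norm ((x - y) $ i) \<le> norm ((vec (h / 2) :: real ^ 'n) $ i)" for i
    using assms(1) by (auto simp: mem_box_cart grid_point_def x_def e_def algebra_simps
        split: if_splits dest!: spec[of _ i])
  then have "norm (x - y) \<le> norm (vec (h / 2) :: real ^ 'n)"
    by (rule norm_le_componentwise_cart)
  then have "dist x y \<le> sqrt (real CARD('n)) * h / 2"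
    using assms(1) by (simp add: dist_norm norm_vec_def L2_set_constant)
  ultimately show ?thesis by blast
qed

lemma grid_hausdorff_dist_commute:
  "grid_hausdorff_dist p h K A B = grid_hausdorff_dist p h K B A"
  unfolding grid_hausdorff_dist_def by (simp add: abs_minus_commute)

lemma hausdorff_excess_le_grid:
  fixes A B :: "(real ^ 'n) set"
  assumes "A \<noteq> {}" and "0 \<le> h" and "grid_covers p h K A"
  shows "hausdorff_excess A B \<le> grid_hausdorff_dist p h K A B + sqrt (real CARD('n)) * h"
  unfolding hausdorff_excess_def
proof (rule cSUP_least)
  fix y assume "y \<in> A"
  then obtain c where c: "c \<in> grid_cells K" "y \<in> convex hull (cell_corners p h c)"
    using assms(3) unfolding grid_covers_def by blast
  obtain x where x: "x \<in> cell_corners p h c" "dist x y \<le> sqrt (real CARD('n)) * h / 2"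
    using exists_cell_corner_near[OF assms(2) c(2)] by blast
  have "x \<in> grid_points p h K"
    using cell_corners_subset_grid_points[OF c(1)] x(1) by blast
  then have "\<bar>infdist x A - infdist x B\<bar> \<le> grid_hausdorff_dist p h K A B"
    unfolding grid_hausdorff_dist_def by (intro Max_ge) (auto simp: finite_grid_points)
  moreover have "infdist y B \<le> infdist x B + dist y x"
    by (rule infdist_triangle)
  \<comment> \<open>The point \<open>y\<close> of \<open>A\<close> itself competes in the infimum;
    this is the Lipschitz bound for the distance to \<open>A\<close>, which vanishes at
    \<open>y\<close>.\<close>
  moreover have "infdist x A \<le> dist x y"
    using \<open>y \<in> A\<close> by (rule infdist_le)
  \<comment> \<open>The distance \<open>dist x y\<close> enters twice, once for each set, so the two
    halves add up to the full error term.\<close>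
  ultimately show "infdist y B \<le> grid_hausdorff_dist p h K A B + sqrt (real CARD('n)) * h"
    using x(2) by (simp add: dist_commute)
qed (rule assms(1))

theorem corollary1:
  fixes A B :: "(real ^ 'n) set" and p :: "real ^ 'n" and h :: real and K :: "int ^ 'n"
  assumes "A \<noteq> {}" and "compact A"
    and "B \<noteq> {}" and "compact B"
    and "h > 0" and "\<forall>i. K $ i \<ge> 1"
    and "grid_covers p h K (A \<union> B)"
  shows "hausdorff_dist A B - grid_hausdorff_dist p h K A B \<le> sqrt (real CARD('n)) * h"
proof -
  have "grid_covers p h K A" "grid_covers p h K B"
    using assms(7) unfolding grid_covers_def by auto
  then show ?thesis
    \<comment> \<open>Both excesses obey the same bound because the grid distance is symmetric,
      hence so does their maximum.\<close>
    using hausdorff_excess_le_grid[of A h p K B] hausdorff_excess_le_grid[of B h p K A] assms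
    by (simp add: hausdorff_dist_def grid_hausdorff_dist_commute[of p h K B A])
qed

end
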